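(* Let an instance of the Fixed-Permutation Splitting and Charging Problem (FPSCP) be given, as described in the context, together with a fixed customer permutation $\pi=(\pi_1,\dots,\pi_n)$. If the FPSCP instance for $\pi$ admits at least one feasible solution, then Algorithm FP-FLA (described in the context) returns a feasible solution $S$ of $\pi$ whose total distance $f(S)$ is minimum among all feasible solutions for $\pi$. That is, the algorithm computes an optimal decoding of the given permutation.
   Context: FPSCP instance. Let $G=(V,E)$ be a complete graph with $V=\{\delta\}\cup V_c\cup V_f$, where $\delta$ is the depot, $V_c=\{c_1,\dots,c_n\}$ is the set of customers and $V_f$ is the set of charging stations. Each pair $i,j$ has Euclidean distance $d_{ij}$, and traversing it consumes $h\,d_{ij}$ battery energy, where $h>0$. Each customer $i$ has demand $q_i\ge 0$; set $q_\delta=0$. All vehicles have cargo capacity $Q$ and battery capacity $B$. A solution for a permutation $\pi$ of $V_c$ is a node sequence $S=(s_0,\dots,s_L)$ with $s_0=s_L=\delta$ and $s_\ell\in V$, such that deleting all non-customer nodes from $S$ yields exactly $\pi$. The depot occurrences split $S$ into routes $R=(r_0,\dots,r_T)$, each with $r_0=r_T=\delta$ and no intermediate $\delta$. For such a route let $q(R)=\sum_{t:\,r_t\in V_c}q_{r_t}$. Define battery consumption by $b_0=0$ and, for $t=0,\dots,T-1$, $b_{t+1}=h d_{r_t r_{t+1}}$ if $r_t\in V_f\cup\{\delta\}$ and $b_{t+1}=b_t+h d_{r_t r_{t+1}}$ if $r_t\in V_c$. The solution $S$ is feasible if every route satisfies $q(R)\le Q$ and $b_t\le B$ for all $t$. Its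 cost is $f(S)=\sum_{\ell=0}^{L-1}d_{s_\ell s_{\ell+1}}$, and the FPSCP asks for a feasible $S$ minimizing $f(S)$. Algorithm FP-FLA. Let $\mathbf F_{u,v}$ be the shortest-path distance from $u$ to $v$ in the graph on vertex set $V_f\cup\{\delta\}$ whose edges are the pairs $\{u,v\}$ with $h d_{uv}\le B$, weighted by $d_{uv}$. Here $\mathbf F_{u,u}=0$, and $\mathbf F_{u,v}=\infty$ if $v$ is unreachable from $u$. Let $\pi'=(\pi'_0,\dots,\pi'_{n+1})=(\delta,\pi_1,\dots,\pi_n,\delta)$. A label is a triple $(d,q,b)$ giving accumulated distance, cargo since the last depot visit, and battery consumed since the last depot or charging-station visit. Each label also stores back-pointers so that the corresponding node sequence can be reconstructed. Start with $front_0=\{(0,0,0)\}$. For $i=1,\dots,n+1$, every label $(d^{i-1},q^{i-1},b^{i-1})\in front_{i-1}$ is extended to candidate labels as follows. (1) Direct extension: $(d^{i-1}+d_{\pi'_{i-1}\pi'_i},\; q^{i-1}+q_{\pi'_i},\; b^{i-1}+h d_{\pi'_{i-1}\pi'_i})$, kept if its cargo is $\le Q$ and its battery is $\le B$. (2) Charging detour, for every pair $f_{in},f_{out}\in V_f\cup\{\delta\}$: $(d^{i-1}+d_{\pi'_{i-1}f_{in}}+\mathbf F_{f_{in},f_{out}}+d_{f_{out}\pi'_i},\; q^{i-1}+q_{\pi'_i},\; h d_{f_{out}\pi'_i})$. (3) Depot detour, for every pair $f_{in},f_{out}\in V_f\cup\{\delta\}$: $(d^{i-1}+d_{\pi'_{i-1}f_{in}}+\mathbf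 F_{f_{in},\delta}+\mathbf F_{\delta,f_{out}}+d_{f_{out}\pi'_i},\; q_{\pi'_i},\; h d_{f_{out}\pi'_i})$. The corresponding node sequence realizes the $\mathbf F$ terms by shortest paths. Detour labels (2) and (3) are kept if $b^{i-1}+h d_{\pi'_{i-1}f_{in}}\le B$, the new cargo is $\le Q$, and the new battery is $\le B$. $front_i$ is the set of kept candidates after removing every label that is Pareto-dominated, where $(d,q,b)$ is dominated by $(d',q',b')$ if $d'\le d$, $q'\le q$, $b'\le b$ with at least one inequality strict. If $front_{n+1}$ is empty, the algorithm reports infeasibility. Otherwise it returns the minimum-distance label of $front_{n+1}$ together with its reconstructed node sequence. *)

theory Defs
  imports
    "HOL-Analysis.Analysis"
    "HOL-Library.Sublist"
    "HOL-Combinatorics.Multiset_Permutations"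
    "Graph_Theory.Shortest_Path"
begin

subsection \<open>Instances, solutions and cost\<close>

record ('v, 'p) fpscp =
  depot :: 'v
  customers :: "'v set"
  stations :: "'v set"
  pos :: "'v \<Rightarrow> 'p"
  rate :: real
  demand :: "'v \<Rightarrow> real"
  cargo_cap :: real
  battery_cap :: real

definition nodes :: "('v, 'p) fpscp \<Rightarrow> 'v set" where
  "nodes I = {depot I} \<union> customers I \<union> stations I"

definition recharge_nodes :: "('v, 'p) fpscp \<Rightarrow> 'v set" where
  "recharge_nodes I = stations I \<union> {depot I}"

definition fpscp_instance :: "('v, 'p::euclidean_space) fpscp \<Rightarrow> bool" where
  "fpscp_instance I \<longleftrightarrow>
     finite (customers I) \<and> finite (stations I) \<and>
     customers I \<inter> recharge_nodes I = {} \<and>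
     rate I > 0 \<and>
     (\<forall>c\<in>customers I. demand I c \<ge> 0) \<and> demand I (depot I) = 0"

definition ndist :: "('v, 'p::euclidean_space) fpscp \<Rightarrow> 'v \<Rightarrow> 'v \<Rightarrow> real" where
  "ndist I u v = dist (pos I u) (pos I v)"

definition energy :: "('v, 'p::euclidean_space) fpscp \<Rightarrow> 'v \<Rightarrow> 'v \<Rightarrow> real" where
  "energy I u v = rate I * ndist I u v"

definition is_solution :: "('v, 'p) fpscp \<Rightarrow> 'v list \<Rightarrow> 'v list \<Rightarrow> bool" where
  "is_solution I \<pi> S \<longleftrightarrow>
     S \<noteq> [] \<and> hd S = depot I \<and> last S = depot I \<and> set S \<subseteq> nodes I \<and>
     filter (\<lambda>v. v \<in> customers I) S = \<pi>"

text \<open>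
  A route is a contiguous segment of \<open>S\<close> between two successive depot occurrences.
  The one-node segment consisting of the depot alone (no moves at all) is admitted as well. It only
  requires the capacities to be nonnegative, which every longer route requires anyway, so it
  matters only for the solution \<open>S = [depot I]\<close>, which has no other route.
\<close>

definition is_route :: "('v, 'p) fpscp \<Rightarrow> 'v list \<Rightarrow> 'v list \<Rightarrow> bool" where
  "is_route I S R \<longleftrightarrow>
     sublist R S \<and> R \<noteq> [] \<and> hd R = depot I \<and> last R = depot I \<and>
     (\<forall>t. 0 < t \<and> t < length R - 1 \<longrightarrow> R ! t \<noteq> depot I)"

definition route_load :: "('v, 'p) fpscp \<Rightarrow> 'v list \<Rightarrow> real" where
  "route_load I R = (\<Sum>v \<leftarrow> filter (\<lambda>v. v \<in> customers I) R. demand I v)"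

primrec battery_used :: "('v, 'p::euclidean_space) fpscp \<Rightarrow> 'v list \<Rightarrow> nat \<Rightarrow> real" where
  "battery_used I R 0 = 0"
| "battery_used I R (Suc t) =
     (if R ! t \<in> recharge_nodes I then energy I (R ! t) (R ! Suc t)
      else battery_used I R t + energy I (R ! t) (R ! Suc t))"

definition feasible :: "('v, 'p::euclidean_space) fpscp \<Rightarrow> 'v list \<Rightarrow> 'v list \<Rightarrow> bool" where
  "feasible I \<pi> S \<longleftrightarrow>
     is_solution I \<pi> S \<and>
     (\<forall>R. is_route I S R \<longrightarrow>
        route_load I R \<le> cargo_cap I \<and>
        (\<forall>t < length R. battery_used I R t \<le> battery_cap I))"

definition total_distance :: "('v, 'p::euclidean_space) fpscp \<Rightarrow> 'v list \<Rightarrow> real" where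
  "total_distance I S = (\<Sum>l < length S - 1. ndist I (S ! l) (S ! Suc l))"


subsection \<open>Shortest paths between recharging nodes\<close>

text \<open>The undirected graph is represented by its symmetric digraph.\<close>

definition recharge_graph ::
  "('v, 'p::euclidean_space) fpscp \<Rightarrow> ('v, 'v \<times> 'v) pre_digraph" where
  "recharge_graph I =
     \<lparr>verts = recharge_nodes I,
      arcs = {(u, v). u \<in> recharge_nodes I \<and> v \<in> recharge_nodes I \<and> u \<noteq> v \<and>
                      energy I u v \<le> battery_cap I},
      tail = fst, head = snd\<rparr>"

lemma wf_digraph_recharge_graph: "wf_digraph (recharge_graph I)"
  by unfold_locales (auto simp: recharge_graph_def)

definition sp_dist :: "('v, 'p::euclidean_space) fpscp \<Rightarrow> 'v \<Rightarrow> 'v \<Rightarrow> ereal" where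
  "sp_dist I u v = wf_digraph.\<mu> (recharge_graph I) (\<lambda>(x, y). ndist I x y) u v"

text \<open>\<open>P\<close> is the node sequence (both ends included) of a shortest path from \<open>u\<close> to \<open>v\<close>.\<close>

definition shortest_path ::
  "('v, 'p::euclidean_space) fpscp \<Rightarrow> 'v \<Rightarrow> 'v \<Rightarrow> 'v list \<Rightarrow> bool" where
  "shortest_path I u v P \<longleftrightarrow>
     (\<exists>p. pre_digraph.apath (recharge_graph I) u p v \<and>
          ereal (wf_digraph.awalk_cost (\<lambda>(x, y). ndist I x y) p) = sp_dist I u v \<and>
          P = pre_digraph.awalk_verts (recharge_graph I) u p)"


subsection \<open>Algorithm FP-FLA\<close>

datatype 'v extension = Direct | Charging 'v 'v | Via_Depot 'v 'v

text \<open>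
  The back-pointer of a label is its predecessor label together with the extension used. Distances
  are extended reals because the shortest-path distance may be infinite.
\<close>

datatype 'v label =
  Label (lab_dist: ereal) (lab_cargo: real) (lab_battery: real)
        (lab_back: "('v label \<times> 'v extension) option")

fun extend :: "('v, 'p::euclidean_space) fpscp \<Rightarrow> 'v \<Rightarrow> 'v \<Rightarrow> 'v label \<Rightarrow> 'v extension \<Rightarrow> 'v label" where
  "extend I u v l Direct =
     Label (lab_dist l + ereal (ndist I u v))
           (lab_cargo l + demand I v)
           (lab_battery l + energy I u v)
           (Some (l, Direct))"
| "extend I u v l (Charging f_in f_out) =
     Label (lab_dist l + ereal (ndist I u f_in) + sp_dist I f_in f_out + ereal (ndist I f_out v))
           (lab_cargo l + demand I v)
           (energy I f_out v)
           (Some (l, Charging f_in f_out))"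
| "extend I u v l (Via_Depot f_in f_out) =
     Label (lab_dist l + ereal (ndist I u f_in) + sp_dist I f_in (depot I)
              + sp_dist I (depot I) f_out + ereal (ndist I f_out v))
           (demand I v)
           (energy I f_out v)
           (Some (l, Via_Depot f_in f_out))"

fun detour_ok :: "('v, 'p::euclidean_space) fpscp \<Rightarrow> 'v \<Rightarrow> 'v label \<Rightarrow> 'v extension \<Rightarrow> bool" where
  "detour_ok I u l Direct \<longleftrightarrow> True"
| "detour_ok I u l (Charging f_in f_out) \<longleftrightarrow>
     f_in \<in> recharge_nodes I \<and> f_out \<in> recharge_nodes I \<and>
     lab_battery l + energy I u f_in \<le> battery_cap I"
| "detour_ok I u l (Via_Depot f_in f_out) \<longleftrightarrow>
     f_in \<in> recharge_nodes I \<and> f_out \<in> recharge_nodes I \<and>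
     lab_battery l + energy I u f_in \<le> battery_cap I"

definition kept_candidates ::
  "('v, 'p::euclidean_space) fpscp \<Rightarrow> 'v \<Rightarrow> 'v \<Rightarrow> 'v label set \<Rightarrow> 'v label set" where
  "kept_candidates I u v F =
     {extend I u v l e | l e. l \<in> F \<and> detour_ok I u l e \<and>
        lab_cargo (extend I u v l e) \<le> cargo_cap I \<and>
        lab_battery (extend I u v l e) \<le> battery_cap I}"

definition dominated_by :: "'v label \<Rightarrow> 'v label \<Rightarrow> bool" where
  "dominated_by l l' \<longleftrightarrow>
     lab_dist l' \<le> lab_dist l \<and> lab_cargo l' \<le> lab_cargo l \<and> lab_battery l' \<le> lab_battery l \<and>
     (lab_dist l' < lab_dist l \<or> lab_cargo l' < lab_cargo l \<or> lab_battery l' < lab_battery l)"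

definition pareto :: "'v label set \<Rightarrow> 'v label set" where
  "pareto L = {l \<in> L. \<not> (\<exists>l' \<in> L. dominated_by l l')}"

definition padded :: "('v, 'p) fpscp \<Rightarrow> 'v list \<Rightarrow> 'v list" where
  "padded I \<pi> = depot I # \<pi> @ [depot I]"

primrec front :: "('v, 'p::euclidean_space) fpscp \<Rightarrow> 'v list \<Rightarrow> nat \<Rightarrow> 'v label set" where
  "front I \<pi> 0 = {Label 0 0 0 None}"
| "front I \<pi> (Suc i) =
     pareto (kept_candidates I (padded I \<pi> ! i) (padded I \<pi> ! Suc i) (front I \<pi> i))"

text \<open>
  Node sequences are reconstructed by following the back-pointers; any shortest path may be used for
  a detour, so this is a relation.
\<close>

fun detour_nodes :: "('v, 'p::euclidean_space) fpscp \<Rightarrow> 'v extension \<Rightarrow> 'v list \<Rightarrow> bool" where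
  "detour_nodes I Direct P \<longleftrightarrow> P = []"
| "detour_nodes I (Charging f_in f_out) P \<longleftrightarrow> shortest_path I f_in f_out P"
| "detour_nodes I (Via_Depot f_in f_out) P \<longleftrightarrow>
     (\<exists>P1 P2. shortest_path I f_in (depot I) P1 \<and> shortest_path I (depot I) f_out P2 \<and>
              P = P1 @ tl P2)"

primrec reconstructs ::
  "('v, 'p::euclidean_space) fpscp \<Rightarrow> 'v list \<Rightarrow> nat \<Rightarrow> 'v label \<Rightarrow> 'v list \<Rightarrow> bool" where
  "reconstructs I \<pi> 0 l S \<longleftrightarrow> lab_back l = None \<and> S = [padded I \<pi> ! 0]"
| "reconstructs I \<pi> (Suc i) l S \<longleftrightarrow>
     (\<exists>l0 e S0 P. lab_back l = Some (l0, e) \<and> reconstructs I \<pi> i l0 S0 \<and>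
        detour_nodes I e P \<and> S = S0 @ P @ [padded I \<pi> ! Suc i])"

datatype 'v outcome = Infeasible | Returned "'v label" "'v list"

text \<open>
  \<open>fp_fla I \<pi> r\<close>: the algorithm may terminate with outcome \<open>r\<close>. Ties between
  minimum-distance labels and between shortest paths may be broken arbitrarily.
\<close>

inductive fp_fla :: "('v, 'p::euclidean_space) fpscp \<Rightarrow> 'v list \<Rightarrow> 'v outcome \<Rightarrow> bool"
  for I :: "('v, 'p::euclidean_space) fpscp" and \<pi> :: "'v list" where
  "front I \<pi> (length \<pi> + 1) = {} \<Longrightarrow> fp_fla I \<pi> Infeasible"
| "l \<in> front I \<pi> (length \<pi> + 1) \<Longrightarrow>
   (\<And>l'. l' \<in> front I \<pi> (length \<pi> + 1) \<Longrightarrow> lab_dist l \<le> lab_dist l') \<Longrightarrow>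
   reconstructs I \<pi> (length \<pi> + 1) l S \<Longrightarrow>
   fp_fla I \<pi> (Returned l S)"

end

theory Submission
  imports Defs
begin

text \<open>
  Feasibility is antitone in the cargo and battery already used, so a partial solution may be
  exchanged for any other one that reaches the same customer with a smaller label; discarding
  dominated labels therefore loses nothing. Between two consecutive customers a feasible solution
  either drives directly or visits a nonempty sequence of recharging nodes. Only the ends of that
  sequence, its length, and whether it contains the depot matter for the rest of the tour, and its
  length is bounded below by the shortest-path distances used in the detour labels. Conversely, a
  label of finite distance is realised by a node sequence of exactly that length. If a shortest path
  of a charging detour happens to pass through the depot, the label merely overestimates the cargo.
\<close>

section \<open>Feasibility of a continuation\<close>

text \<open>
  Both predicates concern the nodes still to be visited, given the cargo \<open>q\<close> and the battery
  consumption \<open>b\<close> with which the current node \<open>u\<close> is left.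
\<close>

primrec cargo_ok :: "('v, 'p) fpscp \<Rightarrow> real \<Rightarrow> 'v list \<Rightarrow> bool" where
  "cargo_ok I q [] \<longleftrightarrow> True"
| "cargo_ok I q (v # xs) \<longleftrightarrow>
     (if v \<in> customers I then q + demand I v \<le> cargo_cap I \<and> cargo_ok I (q + demand I v) xs
      else q \<le> cargo_cap I \<and> cargo_ok I (if v = depot I then 0 else q) xs)"

primrec battery_ok :: "('v, 'p::euclidean_space) fpscp \<Rightarrow> real \<Rightarrow> 'v \<Rightarrow> 'v list \<Rightarrow> bool" where
  "battery_ok I b u [] \<longleftrightarrow> True"
| "battery_ok I b u (v # xs) \<longleftrightarrow>
     b + energy I u v \<le> battery_cap I \<and>
     battery_ok I (if v \<in> recharge_nodes I then 0 else b + energy I u v) v xs"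

abbreviation hop :: "('v, 'p::euclidean_space) fpscp \<Rightarrow> 'v \<Rightarrow> 'v \<Rightarrow> bool" where
  "hop I u v \<equiv> energy I u v \<le> battery_cap I"

lemma total_distance_simps [simp]:
  "total_distance I [] = 0"
  "total_distance I [u] = 0"
  "total_distance I (u # v # xs) = ndist I u v + total_distance I (v # xs)"
  by (simp_all add: total_distance_def sum.lessThan_Suc_shift del: sum.lessThan_Suc)

lemma total_distance_append:
  "xs \<noteq> [] \<Longrightarrow> ys \<noteq> [] \<Longrightarrow> total_distance I (xs @ ys) =
     total_distance I xs + ndist I (last xs) (hd ys) + total_distance I ys"
proof (induction xs rule: induct_list012)
  case (2 x)
  then show ?case by (cases ys) auto
qed auto

lemma cargo_ok_antimono: "cargo_ok I q xs \<Longrightarrow> q' \<le> q \<Longrightarrow> cargo_ok I q' xs"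
proof (induction xs arbitrary: q q')
  case (Cons v xs)
  from Cons.prems Cons.IH[of "q + demand I v" "q' + demand I v"] Cons.IH[of q q'] show ?case
    by (auto split: if_splits)
qed simp

lemma battery_ok_antimono: "battery_ok I b u xs \<Longrightarrow> b' \<le> b \<Longrightarrow> battery_ok I b' u xs"
proof (induction xs arbitrary: b b' u)
  case (Cons v xs)
  from Cons.prems Cons.IH[of "b + energy I u v" v "b' + energy I u v"] show ?case
    by (auto split: if_splits)
qed simp

lemma depot_in_recharge_nodes [simp]: "depot I \<in> recharge_nodes I"
  by (simp add: recharge_nodes_def)

text \<open>Trades the index condition for list decompositions, so that routes can be cut off and
  rejoined by \<open>@\<close>. The one-node route stays a separate case because the other shape has
  two depot positions.\<close>

lemma is_route_iff:
  "is_route I S R \<longleftrightarrow>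
     (\<exists>ps ss. S = ps @ R @ ss) \<and>
     (R = [depot I] \<or> (\<exists>ms. R = depot I # ms @ [depot I] \<and> depot I \<notin> set ms))"
proof -
  have "R \<noteq> [] \<and> hd R = depot I \<and> last R = depot I \<and>
          (\<forall>t. 0 < t \<and> t < length R - 1 \<longrightarrow> R ! t \<noteq> depot I) \<longleftrightarrow>
        R = [depot I] \<or> (\<exists>ms. R = depot I # ms @ [depot I] \<and> depot I \<notin> set ms)"
    (is "?A \<longleftrightarrow> ?B")
  proof
    assume A: ?A
    then obtain xs where R: "R = depot I # xs" by (cases R) auto
    show ?B
    proof (cases xs rule: rev_cases)
      case (snoc ms y)
      have "ms ! t \<noteq> depot I" if "t < length ms" for t
        using A that R snoc by (auto dest!: spec[of _ "Suc t"] simp: nth_append)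
      then show ?thesis using A R snoc by (auto simp: in_set_conv_nth)
    qed (use R in simp)
  next
    assume ?B
    then show ?A by (auto simp: nth_Cons' nth_append in_set_conv_nth split: if_splits)
  qed
  then show ?thesis by (auto simp: is_route_def sublist_def)
qed

text \<open>\<open>battery_used\<close> records the consumption on arrival at a node, while
  \<open>b\<close> is the value with which \<open>u\<close> is left; hence the reset in the
  assumption. The prefix \<open>ps\<close> is arbitrary so that the induction can move
  \<open>u\<close> into it.\<close>

lemma battery_ok_iff_battery_used:
  assumes "b = (if u \<in> recharge_nodes I then 0 else battery_used I (ps @ u # xs) (length ps))"
  shows "battery_ok I b u xs \<longleftrightarrow>
    (\<forall>t. length ps < t \<and> t < length (ps @ u # xs) \<longrightarrow>
       battery_used I (ps @ u # xs) t \<le> battery_cap I)"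
  using assms
proof (induction xs arbitrary: b u ps)
  case (Cons v xs)
  let ?L = "ps @ u # v # xs"
  have v: "battery_used I ?L (Suc (length ps)) = b + energy I u v"
    using Cons.prems by (simp add: nth_append)
  have "battery_ok I (if v \<in> recharge_nodes I then 0 else b + energy I u v) v xs \<longleftrightarrow>
    (\<forall>t. Suc (length ps) < t \<and> t < length ?L \<longrightarrow> battery_used I ?L t \<le> battery_cap I)"
  proof -
    have "(if v \<in> recharge_nodes I then 0 else b + energy I u v) =
      (if v \<in> recharge_nodes I then 0
       else battery_used I ((ps @ [u]) @ v # xs) (length (ps @ [u])))"
      by (simp add: v del: battery_used.simps)
    from Cons.IH[OF this] show ?thesis by (simp del: battery_used.simps)
  qed
  \<comment> \<open>The least index of the range, which is the arrival at \<open>v\<close>, is split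
    off.\<close>
  moreover have "(\<forall>t. m < t \<and> t < n \<longrightarrow> Q t) \<longleftrightarrow> Q (Suc m) \<and> (\<forall>t. Suc m < t \<and> t < n \<longrightarrow> Q t)"
    if "Suc m < n" for Q and m n :: nat
    using that by (metis Suc_lessD Suc_lessI lessI)
  from this[of "length ps" "length ?L" "\<lambda>t. battery_used I ?L t \<le> battery_cap I"]
  have "(\<forall>t. length ps < t \<and> t < length ?L \<longrightarrow> battery_used I ?L t \<le> battery_cap I) \<longleftrightarrow>
    battery_used I ?L (Suc (length ps)) \<le> battery_cap I \<and>
    (\<forall>t. Suc (length ps) < t \<and> t < length ?L \<longrightarrow> battery_used I ?L t \<le> battery_cap I)"
    by simp
  ultimately show ?case
    unfolding v battery_ok.simps by blast
qed auto

text \<open>The depot recharges, so the part after it always starts from consumption 0; routes can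
  thus be checked one by one.\<close>

lemma battery_ok_append_depot:
  "battery_ok I b u (xs @ depot I # ys) \<longleftrightarrow>
     battery_ok I b u (xs @ [depot I]) \<and> battery_ok I 0 (depot I) ys"
  by (induction xs arbitrary: b u) auto

text \<open>Every node of \<open>P\<close> recharges, so only the move into \<open>P\<close> depends
  on \<open>b\<close>, and each inner move is judged on its own as a single hop.\<close>

lemma battery_ok_append_recharge:
  assumes "P \<noteq> []" "set P \<subseteq> recharge_nodes I"
  shows "battery_ok I b u (P @ ys) \<longleftrightarrow>
    b + energy I u (hd P) \<le> battery_cap I \<and> successively (hop I) P \<and> battery_ok I 0 (last P) ys"
  using assms
proof (induction P arbitrary: b u)
  case (Cons p P)
  then show ?case by (cases "P = []") (auto simp: successively_Cons)
qed simp

lemma recharge_graph_simps: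
  "verts (recharge_graph I) = recharge_nodes I"
  "tail (recharge_graph I) = fst"
  "head (recharge_graph I) = snd"
  "(u, v) \<in> arcs (recharge_graph I) \<longleftrightarrow>
     u \<in> recharge_nodes I \<and> v \<in> recharge_nodes I \<and> u \<noteq> v \<and> hop I u v"
  by (auto simp: recharge_graph_def)

section \<open>Continuation feasibility agrees with route feasibility\<close>

locale valid_fpscp =
  fixes I :: "('v, 'p::euclidean_space) fpscp"
  assumes valid: "fpscp_instance I"
begin

lemma customer_not_recharge: "c \<in> customers I \<Longrightarrow> c \<notin> recharge_nodes I"
  using valid by (auto simp: fpscp_instance_def)

lemma depot_not_customer [simp]: "depot I \<notin> customers I"
  using customer_not_recharge depot_in_recharge_nodes by blast

lemma energy_nonneg [simp]: "0 \<le> energy I u v"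
  using valid by (simp add: fpscp_instance_def energy_def ndist_def)

lemma demand_nonneg: "v \<in> customers I \<or> v = depot I \<Longrightarrow> 0 \<le> demand I v"
  using valid by (auto simp: fpscp_instance_def)

lemma demand_depot [simp]: "demand I (depot I) = 0"
  using valid by (simp add: fpscp_instance_def)

lemma finite_recharge_nodes: "finite (recharge_nodes I)"
  using valid by (simp add: fpscp_instance_def recharge_nodes_def)

lemma cargo_ok_append_depot:
  "cargo_ok I q (xs @ depot I # ys) \<longleftrightarrow>
     cargo_ok I q (xs @ [depot I]) \<and> cargo_ok I 0 ys"
  by (induction xs arbitrary: q) auto

text \<open>Once the depot has reset the load to 0, the remaining checks in \<open>P\<close> follow
  from \<open>0 <= q\<close> and \<open>q <= cargo_cap I\<close>.\<close>

lemma cargo_ok_append_recharge: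
  assumes "P \<noteq> []" "set P \<subseteq> recharge_nodes I" "0 \<le> q"
  shows "cargo_ok I q (P @ ys) \<longleftrightarrow>
    q \<le> cargo_cap I \<and> cargo_ok I (if depot I \<in> set P then 0 else q) ys"
  using assms
proof (induction P arbitrary: q)
  case (Cons p P)
  then have "p \<notin> customers I" using customer_not_recharge by auto
  with Cons show ?case by (cases "P = []") auto
qed simp

text \<open>Demands are nonnegative and \<open>ms\<close> contains no reset, so the load only grows
  and the check at the closing depot implies all earlier ones.\<close>

lemma cargo_ok_route:
  assumes "depot I \<notin> set ms"
  shows "cargo_ok I q (ms @ [depot I]) \<longleftrightarrow> q + route_load I ms \<le> cargo_cap I"
  using assms
proof (induction ms arbitrary: q)
  case (Cons v ms)
  have "0 \<le> route_load I xs" for xs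
    unfolding route_load_def by (intro sum_list_nonneg) (auto intro: demand_nonneg)
  from this[of ms] Cons show ?case
    by (auto simp: route_load_def algebra_simps)
qed (simp add: route_load_def)

text \<open>The first route is cut off, and the rest, again starting at a depot, is handled by
  induction on length. The hypothesis speaks of routes and not of \<open>feasible\<close> because
  the rest need not serve the whole permutation.\<close>

lemma feasible_imp_ok:
  assumes "\<And>R. is_route I (depot I # xs) R \<Longrightarrow> route_load I R \<le> cargo_cap I \<and>
             (\<forall>t < length R. battery_used I R t \<le> battery_cap I)"
    and "last (depot I # xs) = depot I"
  shows "cargo_ok I 0 xs \<and> battery_ok I 0 (depot I) xs"
  using assms
proof (induction xs rule: length_induct)
  case (1 xs)
  show ?case
  proof (cases "xs = []")
    case False
    with 1(3) have "depot I \<in> set xs" using last_in_set by fastforce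
    then obtain ms ys where xs: "xs = ms @ depot I # ys" and ms: "depot I \<notin> set ms"
      by (meson split_list_first)
    let ?R = "depot I # ms @ [depot I]"
    have "is_route I (depot I # xs) ?R"
      unfolding is_route_iff using xs ms by (intro conjI exI[of _ "[]"] exI[of _ ys]) auto
    from 1(2)[OF this] have "route_load I ?R \<le> cargo_cap I"
      and "\<forall>t < length ?R. battery_used I ?R t \<le> battery_cap I" by blast+
    then have R: "cargo_ok I 0 (ms @ [depot I])" "battery_ok I 0 (depot I) (ms @ [depot I])"
      using ms cargo_ok_route[OF ms, of 0]
        battery_ok_iff_battery_used[of 0 "depot I" I "[]" "ms @ [depot I]"]
      by (auto simp: route_load_def)
    have "is_route I (depot I # xs) R" if "is_route I (depot I # ys) R" for R
      using that unfolding is_route_iff xs by (metis append.assoc append_Cons)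
    then have "cargo_ok I 0 ys \<and> battery_ok I 0 (depot I) ys"
      using 1 xs by (auto split: if_splits)
    then show ?thesis
      using R unfolding xs by (subst cargo_ok_append_depot, subst battery_ok_append_depot) simp
  qed simp
qed

text \<open>A route starts at a depot, where both predicates restart from 0, and ends at one, so it
  can be isolated from what precedes and follows it. Nonnegative capacities cover the one-node route
  and the index \<open>t = 0\<close>.\<close>

lemma ok_imp_feasible:
  assumes "is_solution I \<pi> (depot I # xs)" "0 \<le> cargo_cap I" "0 \<le> battery_cap I"
    and "cargo_ok I 0 xs" "battery_ok I 0 (depot I) xs"
  shows "feasible I \<pi> (depot I # xs)"
  unfolding feasible_def
proof (intro conjI allI impI assms(1))
  fix R assume "is_route I (depot I # xs) R"
  then obtain ps ss where S: "depot I # xs = ps @ R @ ss"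
    and "R = [depot I] \<or> (\<exists>ms. R = depot I # ms @ [depot I] \<and> depot I \<notin> set ms)"
    unfolding is_route_iff by blast
  then have "route_load I R \<le> cargo_cap I \<and> (\<forall>t < length R. battery_used I R t \<le> battery_cap I)"
  proof (elim disjE exE conjE)
    assume "R = [depot I]"
    then show ?thesis using assms by (simp add: route_load_def)
  next
    fix ms assume R: "R = depot I # ms @ [depot I]" and ms: "depot I \<notin> set ms"
    have "cargo_ok I 0 (ms @ depot I # ss) \<and> battery_ok I 0 (depot I) (ms @ depot I # ss)"
    proof (cases ps)
      case Nil
      then show ?thesis using S R assms by simp
    next
      case (Cons p ps')
      then have "xs = ps' @ depot I # (ms @ depot I # ss)" using S R by simp
      then show ?thesis using assms cargo_ok_append_depot battery_ok_append_depot by metis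
    qed
    then have "cargo_ok I 0 (ms @ [depot I])" "battery_ok I 0 (depot I) (ms @ [depot I])"
      using cargo_ok_append_depot battery_ok_append_depot by metis+
    then have "route_load I ms \<le> cargo_cap I"
      and b: "\<forall>t. 0 < t \<and> t < length R \<longrightarrow> battery_used I R t \<le> battery_cap I"
      using cargo_ok_route[OF ms, of 0]
        battery_ok_iff_battery_used[of 0 "depot I" I "[]" "ms @ [depot I]"] R by auto
    moreover have "route_load I R = route_load I ms" by (simp add: R route_load_def)
    moreover have "battery_used I R t \<le> battery_cap I" if "t < length R" for t
      using b that assms(3) by (cases "t = 0") auto
    ultimately show ?thesis by simp
  qed
  then show "route_load I R \<le> cargo_cap I"
    and "\<And>t. t < length R \<Longrightarrow> battery_used I R t \<le> battery_cap I" by blast+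
qed

end

section \<open>Shortest paths between recharging nodes\<close>

sublocale valid_fpscp \<subseteq> RG: fin_digraph "recharge_graph I"
proof -
  interpret wf_digraph "recharge_graph I" by (rule wf_digraph_recharge_graph)
  show "fin_digraph (recharge_graph I)"
  proof
    show "finite (verts (recharge_graph I))"
      by (simp add: recharge_graph_def finite_recharge_nodes)
    show "finite (arcs (recharge_graph I))"
      by (rule finite_subset[of _ "recharge_nodes I \<times> recharge_nodes I"])
        (auto simp: recharge_graph_def finite_recharge_nodes)
  qed
qed

context valid_fpscp
begin

lemma awalk_cost_nonneg: "RG.awalk u p v \<Longrightarrow> 0 \<le> RG.awalk_cost (\<lambda>(x, y). ndist I x y) p"
  by (rule RG.pos_cost_pos_awalk_cost) (auto simp: ndist_def)

text \<open>Distances are nonnegative, so there is no negative cycle, and in a finite graph the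
  infimum \<open>sp_dist\<close> is then attained by a simple path.\<close>

lemma shortest_path_exists:
  assumes "sp_dist I u v \<noteq> \<infinity>"
  shows "\<exists>P. shortest_path I u v P"
proof -
  have "u \<rightarrow>\<^sup>*\<^bsub>recharge_graph I\<^esub> v"
    using assms RG.shortest_path_inf unfolding sp_dist_def by blast
  then obtain p where "RG.apath u p v"
    "RG.\<mu> (\<lambda>(x, y). ndist I x y) u v = RG.awalk_cost (\<lambda>(x, y). ndist I x y) p"
    using RG.no_neg_cyc_reach_imp_path awalk_cost_nonneg by (metis not_le)
  then show ?thesis unfolding shortest_path_def sp_dist_def by metis
qed

lemma awalk_verts_props:
  assumes "RG.awalk u p v"
  shows "set (RG.awalk_verts u p) \<subseteq> recharge_nodes I \<and> hd (RG.awalk_verts u p) = u \<and>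
    last (RG.awalk_verts u p) = v \<and> successively (hop I) (RG.awalk_verts u p) \<and>
    total_distance I (RG.awalk_verts u p) = RG.awalk_cost (\<lambda>(x, y). ndist I x y) p"
  using assms
proof (induction p arbitrary: u)
  case Nil
  then show ?case by (auto simp: RG.awalk_Nil_iff recharge_graph_simps)
next
  case (Cons a p)
  obtain x w where a: "a = (x, w)" by force
  from Cons.prems a have "x = u" and arc: "u \<in> recharge_nodes I" "hop I u w" and w: "RG.awalk w p v"
    by (auto simp: RG.awalk_Cons_iff recharge_graph_simps)
  have ne: "RG.awalk_verts w p \<noteq> []" by simp
  have th: "tail (recharge_graph I) a = u" "head (recharge_graph I) a = w"
    using a \<open>x = u\<close> by (simp_all add: recharge_graph_simps)
  obtain ys where ys: "RG.awalk_verts w p = w # ys"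
    using Cons.IH[OF w] ne by (metis list.exhaust_sel)
  show ?case
    using Cons.IH[OF w] arc th a \<open>x = u\<close> by (auto simp: ys)
qed

lemma shortest_path_props:
  assumes "shortest_path I u v P"
  shows "P \<noteq> []" "set P \<subseteq> recharge_nodes I" "hd P = u" "last P = v" "successively (hop I) P"
    "sp_dist I u v = ereal (total_distance I P)"
  using assms awalk_verts_props RG.awalk_verts_non_Nil
  by (auto simp: shortest_path_def RG.apath_def)

lemma sp_dist_le_total_distance:
  assumes "P \<noteq> []" "set P \<subseteq> recharge_nodes I" "successively (hop I) P"
  shows "sp_dist I (hd P) (last P) \<le> ereal (total_distance I P)"
proof -
  have "\<exists>p. RG.awalk (hd P) p (last P) \<and>
      RG.awalk_cost (\<lambda>(x, y). ndist I x y) p = total_distance I P"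
    using assms
  proof (induction P rule: induct_list012)
    case (2 u)
    then show ?case by (intro exI[of _ "[]"]) (auto simp: RG.awalk_Nil_iff recharge_graph_simps)
  next
    case (3 u v P)
    then obtain p where p: "RG.awalk v p (last (v # P))"
      "RG.awalk_cost (\<lambda>(x, y). ndist I x y) p = total_distance I (v # P)" by auto
    show ?case
    proof (cases "u = v")
      \<comment> \<open>The graph has no loops; an immediately repeated node adds distance 0 and is
        skipped.\<close>
      case True
      then show ?thesis using p by (intro exI[of _ p]) (auto simp: ndist_def)
    next
      case False
      then show ?thesis using p 3
        by (intro exI[of _ "(u, v) # p"]) (auto simp: RG.awalk_Cons_iff recharge_graph_simps)
    qed
  qed simp
  then show ?thesis unfolding sp_dist_def using RG.min_cost_le_walk_cost by metis
qed


section \<open>A single label extension\<close>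

text \<open>The first cargo clause is an inequality because a shortest path of a
  \<open>Charging\<close> detour may visit the depot, where the true load drops but the label's does
  not. The last clause serves to keep label cargo nonnegative.\<close>

lemma detour_nodes_props:
  assumes "detour_nodes I e P" "detour_ok I u l e" "e \<noteq> Direct" "0 \<le> lab_cargo l"
  shows "P \<noteq> [] \<and> set P \<subseteq> recharge_nodes I \<and> successively (hop I) P \<and>
    lab_battery l + energy I u (hd P) \<le> battery_cap I \<and>
    lab_dist (extend I u v l e) = lab_dist l + ereal (total_distance I (u # P @ [v])) \<and>
    lab_battery (extend I u v l e) = energy I (last P) v \<and>
    (if depot I \<in> set P then 0 else lab_cargo l) + demand I v \<le> lab_cargo (extend I u v l e) \<and>
    demand I v \<le> lab_cargo (extend I u v l e)"
proof -
  have dist: "total_distance I (u # P @ [v]) =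
      ndist I u (hd P) + total_distance I P + ndist I (last P) v" if "P \<noteq> []"
    using that total_distance_append[of P "[v]" I] by (cases P) auto
  show ?thesis
  proof (cases e)
    case (Charging f g)
    then have "shortest_path I f g P" using assms by simp
    note P = shortest_path_props[OF this]
    then show ?thesis
      using assms Charging dist by (cases "lab_dist l") auto
  next
    case (Via_Depot f g)
    then obtain P1 P2 where "shortest_path I f (depot I) P1" "shortest_path I (depot I) g P2"
      and P: "P = P1 @ tl P2"
      using assms by auto
    note P1 = shortest_path_props[OF this(1)] and P2 = shortest_path_props[OF this(2)]
    from P2 obtain ys where ys: "P2 = depot I # ys" by (metis list.exhaust_sel)
    \<comment> \<open>\<open>tl P2\<close> drops the second copy of the depot, with which
      \<open>P1\<close> already ends.\<close>
    have "total_distance I P = total_distance I P1 + total_distance I P2"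
      using P1 P ys total_distance_append[of P1 ys I] by (cases ys) auto
    moreover have "successively (hop I) P"
      using P1 P2 P ys by (auto simp: successively_append_iff successively_Cons)
    moreover have "P \<noteq> []" "set P \<subseteq> recharge_nodes I" "hd P = f" "last P = g"
      using P1 P2 P ys by (auto split: if_splits)
    moreover have "depot I \<in> set P"
      using P1 P by (metis Un_iff last_in_set set_append)
    ultimately show ?thesis
      using P1(6) P2(6) assms(2) Via_Depot dist by (cases "lab_dist l") auto
  qed (use assms in simp)
qed

text \<open>Label cargo is not reset on arrival at \<open>v\<close>, but the true load is if
  \<open>v\<close> is the depot; antitonicity absorbs the difference.
  \<open>battery_ok_ConsI\<close> does the same for the battery.\<close>

lemma cargo_ok_ConsI:
  assumes "v \<in> customers I \<or> v = depot I" "0 \<le> q"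
    and "q + demand I v \<le> cargo_cap I" "cargo_ok I (q + demand I v) ys"
  shows "cargo_ok I q (v # ys)"
  using assms cargo_ok_antimono[of I q ys 0] by auto

lemma battery_ok_ConsI:
  assumes "0 \<le> b" "b + energy I u v \<le> battery_cap I" "battery_ok I (b + energy I u v) v ys"
  shows "battery_ok I b u (v # ys)"
  using assms battery_ok_antimono[OF assms(3), of 0] by auto

text \<open>Continuations are transported backwards over one extension, so that an induction along
  the back-pointers never has to inspect the prefix already built.\<close>

lemma extension_sound:
  assumes "detour_nodes I e P" "detour_ok I u l e" "0 \<le> lab_cargo l" "0 \<le> lab_battery l"
    and "lab_cargo l \<le> cargo_cap I"
    and v: "v \<in> customers I \<or> v = depot I"
    and caps: "lab_cargo (extend I u v l e) \<le> cargo_cap I"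
      "lab_battery (extend I u v l e) \<le> battery_cap I"
  shows "lab_dist (extend I u v l e) = lab_dist l + ereal (total_distance I (u # P @ [v]))"
    and "set P \<subseteq> recharge_nodes I"
    and "0 \<le> lab_cargo (extend I u v l e)" and "0 \<le> lab_battery (extend I u v l e)"
    and "cargo_ok I (lab_cargo (extend I u v l e)) ys \<Longrightarrow> cargo_ok I (lab_cargo l) (P @ v # ys)"
    and "battery_ok I (lab_battery (extend I u v l e)) v ys \<Longrightarrow>
      battery_ok I (lab_battery l) u (P @ v # ys)"
proof (atomize (full), goal_cases)
  case 1
  show ?case
  proof (cases "e = Direct")
    case True
    then have "P = []" using assms by simp
    moreover have "cargo_ok I (lab_cargo l) (v # ys)"
      if "cargo_ok I (lab_cargo l + demand I v) ys"
      using that True caps(1) by (intro cargo_ok_ConsI v assms) simp_all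
    moreover have "battery_ok I (lab_battery l) u (v # ys)"
      if "battery_ok I (lab_battery l + energy I u v) v ys"
      using that True caps(2) by (intro battery_ok_ConsI assms) simp_all
    ultimately show ?thesis
      using True assms(3,4) demand_nonneg[OF v]
      by (simp del: cargo_ok.simps battery_ok.simps)
  next
    case False
    let ?l = "extend I u v l e" and ?q = "if depot I \<in> set P then 0 else lab_cargo l"
    from detour_nodes_props[OF assms(1,2) False assms(3), of v]
    have P: "P \<noteq> []" "set P \<subseteq> recharge_nodes I" "successively (hop I) P"
      "lab_battery l + energy I u (hd P) \<le> battery_cap I"
      and l: "lab_dist ?l = lab_dist l + ereal (total_distance I (u # P @ [v]))"
        "lab_battery ?l = energy I (last P) v" "?q + demand I v \<le> lab_cargo ?l"
        "demand I v \<le> lab_cargo ?l"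
      by blast+
    have "cargo_ok I (lab_cargo l) (P @ v # ys)" if "cargo_ok I (lab_cargo ?l) ys"
    proof -
      have "cargo_ok I ?q (v # ys)"
      proof (rule cargo_ok_ConsI[OF v])
        show "0 \<le> ?q" using assms(3) by simp
        show "?q + demand I v \<le> cargo_cap I" using l(3) caps(1) by linarith
        show "cargo_ok I (?q + demand I v) ys" using that l(3) by (rule cargo_ok_antimono)
      qed
      then show ?thesis
        using cargo_ok_append_recharge[OF P(1,2) assms(3)] assms(5) by blast
    qed
    moreover have "battery_ok I (lab_battery l) u (P @ v # ys)"
      if "battery_ok I (lab_battery ?l) v ys"
    proof -
      have "battery_ok I 0 (last P) (v # ys)"
        using that l(2) caps by (intro battery_ok_ConsI) auto
      then show ?thesis
        using battery_ok_append_recharge[OF P(1,2)] P(3,4) by blast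
    qed
    moreover have "0 \<le> lab_cargo ?l" "0 \<le> lab_battery ?l"
      using l(2,4) demand_nonneg[OF v] by simp_all
    ultimately show ?thesis
      using P(2) l(1) by blast
  qed
qed

lemma extension_complete:
  assumes ms: "set ms \<subseteq> recharge_nodes I" and "0 \<le> lab_cargo l"
    and v: "v \<in> customers I \<or> v = depot I \<and> ys = []"
    and c: "cargo_ok I (lab_cargo l) (ms @ v # ys)"
    and b: "battery_ok I (lab_battery l) u (ms @ v # ys)"
  obtains e where "detour_ok I u l e"
    and "lab_cargo (extend I u v l e) \<le> cargo_cap I"
    and "lab_battery (extend I u v l e) \<le> battery_cap I"
    and "lab_dist (extend I u v l e) \<le> lab_dist l + ereal (total_distance I (u # ms @ [v]))"
    and "cargo_ok I (lab_cargo (extend I u v l e)) ys"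
    and "battery_ok I (lab_battery (extend I u v l e)) v ys"
proof (cases "ms = []")
  case True
  show thesis
    by (rule that[of Direct]) (use True c b v customer_not_recharge[of v] in auto)
next
  case False
  have v_last: "v \<in> customers I \<longrightarrow> v \<notin> recharge_nodes I" using customer_not_recharge by blast
  have cargo: "cargo_ok I (if depot I \<in> set ms then 0 else lab_cargo l) (v # ys)"
    using c cargo_ok_append_recharge[OF False ms assms(2)] by blast
  have batt: "lab_battery l + energy I u (hd ms) \<le> battery_cap I" "successively (hop I) ms"
      "battery_ok I 0 (last ms) (v # ys)"
    using b battery_ok_append_recharge[OF False ms] by blast+
  have ends: "hd ms \<in> recharge_nodes I" "last ms \<in> recharge_nodes I"
    using False ms by auto
  have dist: "total_distance I (u # ms @ [v]) =
      ndist I u (hd ms) + total_distance I ms + ndist I (last ms) v"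
    using False total_distance_append[of ms "[v]" I] by (cases ms) auto
  show thesis
  proof (cases "depot I \<in> set ms")
    case no_depot: False
    have "lab_dist (extend I u v l (Charging (hd ms) (last ms))) \<le>
        lab_dist l + ereal (ndist I u (hd ms)) + ereal (total_distance I ms)
          + ereal (ndist I (last ms) v)"
      using sp_dist_le_total_distance[OF False ms batt(2)] by (auto intro!: add_mono)
    also have "\<dots> = lab_dist l + ereal (total_distance I (u # ms @ [v]))"
      by (cases "lab_dist l") (simp_all add: dist)
    finally show thesis
      by (rule that[of "Charging (hd ms) (last ms)", rotated 3])
        (use cargo batt ends no_depot v v_last in auto)
  next
    case True
    \<comment> \<open>Any occurrence of the depot will do: both halves are sequences of hops between
      recharging nodes, so \<open>sp_dist\<close> bounds each length from below.\<close>
    then obtain xs zs where xz: "ms = xs @ depot I # zs" by (meson split_list)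
    have "sp_dist I (hd (xs @ [depot I])) (last (xs @ [depot I])) \<le>
        ereal (total_distance I (xs @ [depot I]))"
      using ms batt(2) by (intro sp_dist_le_total_distance)
        (auto simp: xz successively_append_iff successively_Cons)
    then have 1: "sp_dist I (hd ms) (depot I) \<le> ereal (total_distance I (xs @ [depot I]))"
      by (cases xs) (simp_all add: xz)
    have "sp_dist I (hd (depot I # zs)) (last (depot I # zs)) \<le>
        ereal (total_distance I (depot I # zs))"
      using ms batt(2) by (intro sp_dist_le_total_distance)
        (auto simp: xz successively_append_iff)
    then have 2: "sp_dist I (depot I) (last ms) \<le> ereal (total_distance I (depot I # zs))"
      by (simp add: xz)
    have split: "total_distance I ms =
        total_distance I (xs @ [depot I]) + total_distance I (depot I # zs)"
      unfolding xz by (cases "xs = []") (simp_all add: total_distance_append)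
    have "lab_dist (extend I u v l (Via_Depot (hd ms) (last ms))) \<le>
        lab_dist l + ereal (ndist I u (hd ms)) + ereal (total_distance I (xs @ [depot I]))
          + ereal (total_distance I (depot I # zs)) + ereal (ndist I (last ms) v)"
      using 1 2 by (auto intro!: add_mono)
    also have "\<dots> = lab_dist l + ereal (total_distance I (u # ms @ [v]))"
      by (cases "lab_dist l") (simp_all add: dist split)
    finally show thesis
      by (rule that[of "Via_Depot (hd ms) (last ms)", rotated 3])
        (use cargo batt ends True v v_last in auto)
  qed
qed

section \<open>Finiteness and Pareto filtering\<close>

lemma finite_kept_candidates:
  assumes "finite F"
  shows "finite (kept_candidates I u v F)"
proof -
  let ?R = "recharge_nodes I \<times> recharge_nodes I"
  let ?E = "{Direct} \<union> case_prod Charging ` ?R \<union> case_prod Via_Depot ` ?R"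
  have "e \<in> ?E" if "detour_ok I u l e" for l e
    using that by (cases e) auto
  then have "kept_candidates I u v F \<subseteq> case_prod (extend I u v) ` (F \<times> ?E)"
    unfolding kept_candidates_def by fastforce
  then show ?thesis
    using assms finite_recharge_nodes by (auto intro: finite_subset)
qed

lemma finite_front: "finite (front I \<pi> i)"
  by (induction i) (simp_all add: pareto_def finite_kept_candidates)

end

text \<open>Dominance is transitive and irreflexive, so passing to a dominator strictly shrinks the
  finite set of dominators until an undominated label is reached.\<close>

lemma pareto_weakly_dominates:
  assumes "finite L" "l \<in> L"
  shows "\<exists>l' \<in> pareto L. lab_dist l' \<le> lab_dist l \<and> lab_cargo l' \<le> lab_cargo l \<and>
    lab_battery l' \<le> lab_battery l"
  using assms(2)
proof (induction "card {l' \<in> L. dominated_by l l'}" arbitrary: l rule: less_induct)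
  case less
  show ?case
  proof (cases "l \<in> pareto L")
    case False
    then obtain m where m: "m \<in> L" "dominated_by l m"
      using less.prems by (auto simp: pareto_def)
    have "{l' \<in> L. dominated_by m l'} \<subset> {l' \<in> L. dominated_by l l'}"
      using m by (auto simp: dominated_by_def)
    then have "card {l' \<in> L. dominated_by m l'} < card {l' \<in> L. dominated_by l l'}"
      using assms(1) by (intro psubset_card_mono) auto
    from less.hyps[OF this m(1)] m(2) show ?thesis
      unfolding dominated_by_def by (meson order_trans)
  qed auto
qed

section \<open>Soundness and completeness of the fronts\<close>

lemma padded_nth:
  "padded I \<pi> ! 0 = depot I"
  "i < length \<pi> \<Longrightarrow> padded I \<pi> ! Suc i = \<pi> ! i"
  "padded I \<pi> ! Suc (length \<pi>) = depot I"
  by (simp_all add: padded_def nth_append)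

context valid_fpscp
begin

lemma front_SucE:
  assumes "l \<in> front I \<pi> (Suc i)"
  obtains l0 e where "l0 \<in> front I \<pi> i" "detour_ok I (padded I \<pi> ! i) l0 e"
    "l = extend I (padded I \<pi> ! i) (padded I \<pi> ! Suc i) l0 e"
    "lab_cargo l \<le> cargo_cap I" "lab_battery l \<le> battery_cap I"
  using assms by (auto simp: pareto_def kept_candidates_def)

lemma lab_back_extend: "lab_back (extend I u v l e) = Some (l, e)"
  by (cases e) auto

text \<open>A single infinite summand makes an \<open>ereal\<close> sum infinite, so every shortest
  path called for along the back-pointers exists.\<close>

lemma reconstructs_exists:
  assumes "l \<in> front I \<pi> i" "lab_dist l \<noteq> \<infinity>"
  shows "\<exists>S. reconstructs I \<pi> i l S"
  using assms
proof (induction i arbitrary: l)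
  case (Suc i)
  from Suc.prems(1) obtain l0 e where l0: "l0 \<in> front I \<pi> i"
    and l: "l = extend I (padded I \<pi> ! i) (padded I \<pi> ! Suc i) l0 e"
    by (rule front_SucE)
  have "lab_dist l0 \<noteq> \<infinity> \<and> (\<exists>P. detour_nodes I e P)"
  proof (cases e)
    case (Charging f g)
    then show ?thesis using Suc.prems(2) l shortest_path_exists[of f g] by auto
  next
    case (Via_Depot f g)
    then show ?thesis using Suc.prems(2) l shortest_path_exists[of f "depot I"]
        shortest_path_exists[of "depot I" g] by auto
  qed (use Suc.prems(2) l in auto)
  then obtain S0 P where "reconstructs I \<pi> i l0 S0" "detour_nodes I e P"
    using Suc.IH l0 by blast
  then have "reconstructs I \<pi> (Suc i) l (S0 @ P @ [padded I \<pi> ! Suc i])"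
    using l lab_back_extend by auto
  then show ?case ..
qed auto

text \<open>
  The last two conjuncts say that a continuation that is feasible from the label is feasible after
  the reconstructed sequence. The converse fails, as labels may overestimate the cargo.
\<close>

lemma reconstructs_sound:
  assumes "reconstructs I \<pi> i l S" "l \<in> front I \<pi> i" "i \<le> length \<pi> + 1"
    and "set \<pi> = customers I" "0 \<le> cargo_cap I"
  shows "\<exists>xs. S = depot I # xs \<and> last S = padded I \<pi> ! i \<and> set S \<subseteq> nodes I \<and>
    filter (\<lambda>v. v \<in> customers I) S = take i \<pi> \<and> lab_dist l = ereal (total_distance I S) \<and>
    0 \<le> lab_cargo l \<and> 0 \<le> lab_battery l \<and> lab_cargo l \<le> cargo_cap I \<and>
    (\<forall>ys. cargo_ok I (lab_cargo l) ys \<longrightarrow> cargo_ok I 0 (xs @ ys)) \<and>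
    (\<forall>ys. battery_ok I (lab_battery l) (padded I \<pi> ! i) ys \<longrightarrow>
       battery_ok I 0 (depot I) (xs @ ys))"
  using assms(1-3)
proof (induction i arbitrary: l S)
  case 0
  then show ?case using assms(5) by (auto simp: padded_nth nodes_def zero_ereal_def)
next
  case (Suc i)
  let ?u = "padded I \<pi> ! i" and ?v = "padded I \<pi> ! Suc i"
  from Suc.prems(2) obtain l0 e where l0: "l0 \<in> front I \<pi> i" and e: "detour_ok I ?u l0 e"
    and l: "l = extend I ?u ?v l0 e"
    and caps: "lab_cargo l \<le> cargo_cap I" "lab_battery l \<le> battery_cap I"
    by (rule front_SucE)
  \<comment> \<open>The stored back-pointer is the very pair \<open>(l0, e)\<close>, so the
    predecessor used by \<open>reconstructs\<close> lies on front \<open>i\<close>.\<close>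
  from Suc.prems(1) l lab_back_extend obtain S0 P where S0: "reconstructs I \<pi> i l0 S0"
    and P: "detour_nodes I e P" and S: "S = S0 @ P @ [?v]"
    by auto
  from Suc.IH[OF S0 l0] Suc.prems(3) obtain xs where xs: "S0 = depot I # xs" "last S0 = ?u"
      "set S0 \<subseteq> nodes I" "filter (\<lambda>v. v \<in> customers I) S0 = take i \<pi>"
      "lab_dist l0 = ereal (total_distance I S0)"
    and inv: "0 \<le> lab_cargo l0" "0 \<le> lab_battery l0" "lab_cargo l0 \<le> cargo_cap I"
    and ok: "\<And>ys. cargo_ok I (lab_cargo l0) ys \<Longrightarrow> cargo_ok I 0 (xs @ ys)"
      "\<And>ys. battery_ok I (lab_battery l0) ?u ys \<Longrightarrow> battery_ok I 0 (depot I) (xs @ ys)"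
    by auto
  \<comment> \<open>Either the next customer is appended or, at the last index, the depot, which the
    filter drops; \<open>take (Suc i)\<close> is then the whole permutation.\<close>
  have v: "?v \<in> customers I \<or> ?v = depot I"
    and filter_v: "take i \<pi> @ filter (\<lambda>v. v \<in> customers I) [?v] = take (Suc i) \<pi>"
    using Suc.prems(3) assms(4) nth_mem[of i \<pi>]
    by (cases "i < length \<pi>"; auto simp: padded_nth take_Suc_conv_app_nth le_Suc_eq)+
  note step = extension_sound[OF P e inv v caps[unfolded l], folded l]
  have "filter (\<lambda>v. v \<in> customers I) P = []"
    using step(2) customer_not_recharge by (auto simp: filter_empty_conv)
  then have "filter (\<lambda>v. v \<in> customers I) S = take (Suc i) \<pi>"
    using xs(4) filter_v by (simp add: S)
  moreover have "total_distance I S = total_distance I S0 + total_distance I (?u # P @ [?v])"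
    using xs(1,2) total_distance_append[of S0 "P @ [?v]" I]
    by (cases "P @ [?v]") (auto simp: S)
  then have "lab_dist l = ereal (total_distance I S)"
    using step(1) xs(5) by simp
  moreover have "set S \<subseteq> nodes I"
    using xs(3) step(2) v by (auto simp: S nodes_def recharge_nodes_def)
  moreover have "cargo_ok I 0 ((xs @ P @ [?v]) @ ys)" if "cargo_ok I (lab_cargo l) ys" for ys
    using ok(1) step(5)[OF that] by simp
  moreover have "battery_ok I 0 (depot I) ((xs @ P @ [?v]) @ ys)"
    if "battery_ok I (lab_battery l) ?v ys" for ys
    using ok(2) step(6)[OF that] by simp
  ultimately show ?case
    using step(3,4) caps xs(1) by (intro exI[of _ "xs @ P @ [?v]"]) (auto simp: S)
qed

text \<open>\<open>reconstructs_sound\<close> covers only labels with a reconstruction; completeness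
  needs this for every label of a front.\<close>

lemma front_labels_nonneg:
  assumes "l \<in> front I \<pi> i" "set \<pi> = customers I" "i \<le> length \<pi> + 1"
  shows "0 \<le> lab_cargo l"
  using assms(1,3)
proof (induction i arbitrary: l)
  case (Suc i)
  let ?u = "padded I \<pi> ! i" and ?v = "padded I \<pi> ! Suc i"
  from Suc.prems(1) obtain l0 e where "l0 \<in> front I \<pi> i" and l: "l = extend I ?u ?v l0 e"
    by (rule front_SucE)
  then have "0 \<le> lab_cargo l0" using Suc by simp
  moreover have "?v \<in> customers I \<or> ?v = depot I"
    using Suc.prems(2) assms(2) nth_mem[of i \<pi>]
    by (cases "i < length \<pi>") (auto simp: padded_nth le_Suc_eq)
  then have "0 \<le> demand I ?v" by (rule demand_nonneg)
  ultimately show ?case by (cases e) (auto simp: l)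
qed simp

text \<open>The Pareto filter may discard the extension just built; a label below it survives in its
  place and, by antitonicity, still admits \<open>ys\<close>.\<close>

lemma front_step:
  assumes "l \<in> front I \<pi> i" "u = padded I \<pi> ! i" "v = padded I \<pi> ! Suc i"
    and "set ms \<subseteq> recharge_nodes I" "0 \<le> lab_cargo l"
    and "v \<in> customers I \<or> v = depot I \<and> ys = []"
    and "cargo_ok I (lab_cargo l) (ms @ v # ys)" "battery_ok I (lab_battery l) u (ms @ v # ys)"
  obtains l' where "l' \<in> front I \<pi> (Suc i)"
    and "lab_dist l' \<le> lab_dist l + ereal (total_distance I (u # ms @ [v]))"
    and "cargo_ok I (lab_cargo l') ys" "battery_ok I (lab_battery l') v ys"
proof -
  let ?K = "kept_candidates I u v (front I \<pi> i)"
  from assms(4-8) obtain e where e: "detour_ok I u l e"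
    "lab_cargo (extend I u v l e) \<le> cargo_cap I" "lab_battery (extend I u v l e) \<le> battery_cap I"
    "lab_dist (extend I u v l e) \<le> lab_dist l + ereal (total_distance I (u # ms @ [v]))"
    "cargo_ok I (lab_cargo (extend I u v l e)) ys"
    "battery_ok I (lab_battery (extend I u v l e)) v ys"
    by (rule extension_complete)
  have "extend I u v l e \<in> ?K"
    using assms(1) e(1-3) unfolding kept_candidates_def by blast
  from pareto_weakly_dominates[OF finite_kept_candidates[OF finite_front] this]
  obtain l' where l': "l' \<in> pareto ?K" "lab_dist l' \<le> lab_dist (extend I u v l e)"
    "lab_cargo l' \<le> lab_cargo (extend I u v l e)"
    "lab_battery l' \<le> lab_battery (extend I u v l e)"
    by blast
  show thesis
  proof (rule that)
    show "l' \<in> front I \<pi> (Suc i)" using l'(1) assms(2,3) by simp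
    show "lab_dist l' \<le> lab_dist l + ereal (total_distance I (u # ms @ [v]))"
      using l'(2) e(4) by (rule order_trans)
    show "cargo_ok I (lab_cargo l') ys" using e(5) l'(3) by (rule cargo_ok_antimono)
    show "battery_ok I (lab_battery l') v ys" using e(6) l'(4) by (rule battery_ok_antimono)
  qed
qed

text \<open>Induction on the number of customers still to be served. Both \<open>l\<close> and
  \<open>xs\<close> vary, because each step may continue from a dominating label instead of the
  extension itself.\<close>

lemma front_complete:
  assumes "i \<le> length \<pi>" "set \<pi> = customers I"
    and "l \<in> front I \<pi> i" "xs \<noteq> []" "last xs = depot I" "set xs \<subseteq> nodes I"
    and "filter (\<lambda>v. v \<in> customers I) xs = drop i \<pi>"
    and "cargo_ok I (lab_cargo l) xs" "battery_ok I (lab_battery l) (padded I \<pi> ! i) xs"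
  shows "\<exists>l' \<in> front I \<pi> (length \<pi> + 1).
    lab_dist l' \<le> lab_dist l + ereal (total_distance I (padded I \<pi> ! i # xs))"
  using assms(1,3-)
proof (induction "length \<pi> - i" arbitrary: i l xs)
  case 0
  then have i: "i = length \<pi>" by simp
  have xs: "xs = butlast xs @ [depot I]"
    using 0 by (metis append_butlast_last_id)
  \<comment> \<open>With no customer left, the last leg consists of recharging nodes, possibly with
    depot visits before the final one.\<close>
  have "set xs \<subseteq> recharge_nodes I"
    using 0 i by (auto simp: filter_empty_conv nodes_def recharge_nodes_def)
  then have "set (butlast xs) \<subseteq> recharge_nodes I"
    by (meson in_set_butlastD subset_iff)
  moreover have "0 \<le> lab_cargo l"
    using front_labels_nonneg 0(3) assms(2) i by simp
  ultimately obtain l' where "l' \<in> front I \<pi> (Suc i)"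
    "lab_dist l' \<le> lab_dist l +
       ereal (total_distance I (padded I \<pi> ! i # butlast xs @ [depot I]))"
    using front_step[of l \<pi> i "padded I \<pi> ! i" "depot I" "butlast xs" "[]"] 0 i xs
    by (auto simp: padded_nth)
  then show ?case using i xs by auto
next
  case (Suc k)
  let ?u = "padded I \<pi> ! i" and ?v = "padded I \<pi> ! Suc i"
  from Suc(2) have i: "i < length \<pi>" by simp
  then have v: "?v = \<pi> ! i" "?v \<in> customers I"
    using assms(2) nth_mem[of i \<pi>] by (auto simp: padded_nth)
  \<comment> \<open>The first customer in \<open>xs\<close> is \<open>?v\<close>; the nodes before
    it form a recharging stretch that one extension accounts for.\<close>
  have "filter (\<lambda>v. v \<in> customers I) xs = ?v # drop (Suc i) \<pi>"
    using Suc.prems i v by (simp add: Cons_nth_drop_Suc)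
  then obtain ms ys where xs: "xs = ms @ ?v # ys" and ms: "\<forall>x \<in> set ms. x \<notin> customers I"
    and ys: "filter (\<lambda>v. v \<in> customers I) ys = drop (Suc i) \<pi>"
    by (auto simp: filter_eq_Cons_iff)
  have "set ms \<subseteq> recharge_nodes I"
    using ms Suc.prems(5) xs by (auto simp: nodes_def recharge_nodes_def)
  moreover have "0 \<le> lab_cargo l"
    using front_labels_nonneg Suc.prems(2) assms(2) i by simp
  ultimately obtain l1 where l1: "l1 \<in> front I \<pi> (Suc i)"
    "lab_dist l1 \<le> lab_dist l + ereal (total_distance I (?u # ms @ [?v]))"
    "cargo_ok I (lab_cargo l1) ys" "battery_ok I (lab_battery l1) ?v ys"
    using front_step[OF Suc.prems(2) refl refl, of ms ys] Suc.prems(7,8) v(2) xs by auto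
  have "ys \<noteq> []" using Suc.prems(4) v(2) xs by auto
  then have "\<exists>l' \<in> front I \<pi> (length \<pi> + 1).
      lab_dist l' \<le> lab_dist l1 + ereal (total_distance I (?v # ys))"
    using Suc.hyps(2) Suc.prems(4,5) i xs ys l1 by (intro Suc.hyps(1)) auto
  then obtain l' where l': "l' \<in> front I \<pi> (length \<pi> + 1)"
    "lab_dist l' \<le> lab_dist l1 + ereal (total_distance I (?v # ys))"
    by blast
  note l'(2)
  also have "lab_dist l1 + ereal (total_distance I (?v # ys)) \<le>
      lab_dist l + ereal (total_distance I (?u # ms @ [?v]))
        + ereal (total_distance I (?v # ys))"
    using l1(2) by (rule add_right_mono)
  also have "\<dots> = lab_dist l + ereal (total_distance I (?u # xs))"
    using \<open>ys \<noteq> []\<close> total_distance_append[of "?u # ms @ [?v]" ys I]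
    by (cases "lab_dist l"; cases ys) (auto simp: xs)
  finally show ?case using l'(1) by blast
qed

text \<open>Every solution contains the one-node route, whose load and consumption are 0.\<close>

lemma feasible_imp_caps_nonneg:
  assumes "feasible I \<pi> S"
  shows "0 \<le> cargo_cap I" "0 \<le> battery_cap I"
proof -
  from assms obtain xs where "S = depot I # xs"
    by (cases S) (auto simp: feasible_def is_solution_def)
  then have "is_route I S [depot I]"
    unfolding is_route_iff by (intro conjI exI[of _ "[]"] exI[of _ xs]) auto
  then have "route_load I [depot I] \<le> cargo_cap I"
    and "\<forall>t < length [depot I]. battery_used I [depot I] t \<le> battery_cap I"
    using assms unfolding feasible_def by blast+
  then show "0 \<le> cargo_cap I" "0 \<le> battery_cap I"
    by (simp_all add: route_load_def)
qed

lemma front_complete_feasible: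
  assumes "feasible I \<pi> S" "set \<pi> = customers I"
  shows "\<exists>l \<in> front I \<pi> (length \<pi> + 1). lab_dist l \<le> ereal (total_distance I S)"
proof -
  from assms(1) obtain xs where S: "S = depot I # xs" and sol: "is_solution I \<pi> S"
    by (cases S) (auto simp: feasible_def is_solution_def)
  have "cargo_ok I 0 xs \<and> battery_ok I 0 (depot I) xs"
    using assms(1) sol by (intro feasible_imp_ok) (auto simp: feasible_def S is_solution_def)
  \<comment> \<open>The trivial solution consisting of the depot alone has no last leg; a zero-length one is added.\<close>
  define ys where "ys = (if xs = [] then [depot I] else xs)"
  have ok: "cargo_ok I 0 ys" "battery_ok I 0 (depot I) ys"
    and dist: "total_distance I (depot I # ys) = total_distance I S"
    using \<open>cargo_ok I 0 xs \<and> _\<close> feasible_imp_caps_nonneg[OF assms(1)]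
    by (auto simp: ys_def S energy_def ndist_def)
  have "ys \<noteq> []" "last ys = depot I" "set ys \<subseteq> nodes I"
    "filter (\<lambda>v. v \<in> customers I) ys = drop 0 \<pi>"
    using sol by (auto simp: ys_def S is_solution_def)
  then show ?thesis
    using front_complete[of 0 \<pi> "Label 0 0 0 None" ys] assms(2) ok dist
    by (simp add: padded_nth del: front.simps(2))
qed

end

section \<open>Optimality of the returned solution\<close>

theorem theorem1:
  fixes I :: "('v, 'p::euclidean_space) fpscp" and \<pi> :: "'v list"
  assumes "fpscp_instance I"
    and "\<pi> \<in> permutations_of_set (customers I)"
    and "\<exists>S. feasible I \<pi> S"
  shows "(\<exists>r. fp_fla I \<pi> r) \<and>
         (\<forall>r. fp_fla I \<pi> r \<longrightarrow>
            (\<exists>l S. r = Returned l S \<and> feasible I \<pi> S \<and>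
                   (\<forall>S'. feasible I \<pi> S' \<longrightarrow> total_distance I S \<le> total_distance I S')))"
proof -
  interpret valid_fpscp I by unfold_locales (rule assms(1))
  let ?F = "front I \<pi> (length \<pi> + 1)"
  have \<pi>: "set \<pi> = customers I"
    using assms(2) by (rule permutations_of_setD(1))
  from assms(3) obtain S0 where S0: "feasible I \<pi> S0" ..
  have complete: "\<exists>l \<in> ?F. lab_dist l \<le> ereal (total_distance I S)" if "feasible I \<pi> S" for S
    using that \<pi> by (rule front_complete_feasible)
  have "\<exists>r. fp_fla I \<pi> r"
  proof -
    have "?F \<noteq> {}" using complete[OF S0] by blast
    then obtain l where l: "l \<in> ?F" "\<And>l'. l' \<in> ?F \<Longrightarrow> lab_dist l \<le> lab_dist l'"
      using arg_min_if_finite[OF finite_front, of \<pi> "length \<pi> + 1" lab_dist] by (meson not_less)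
    \<comment> \<open>The given solution bounds the minimum label distance, which is therefore not
      infinite, so the label can be reconstructed.\<close>
    from complete[OF S0] l(2) have "lab_dist l \<le> ereal (total_distance I S0)"
      by (meson order_trans)
    then have "lab_dist l \<noteq> \<infinity>" by auto
    then obtain S where "reconstructs I \<pi> (length \<pi> + 1) l S"
      using reconstructs_exists l(1) by blast
    then show ?thesis using l fp_fla.intros(2) by blast
  qed
  moreover have "\<exists>l S. r = Returned l S \<and> feasible I \<pi> S \<and>
      (\<forall>S'. feasible I \<pi> S' \<longrightarrow> total_distance I S \<le> total_distance I S')"
    if "fp_fla I \<pi> r" for r
    using that
  proof cases
    case 1
    then show ?thesis using complete[OF S0] by simp
  next
    case (2 l S)
    note caps = feasible_imp_caps_nonneg[OF S0]
    \<comment> \<open>The empty continuation is feasible from any label, so the reconstructed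
      sequence is feasible by itself.\<close>
    from reconstructs_sound[OF 2(4,2) order_refl \<pi> caps(1)] obtain xs where
      S: "S = depot I # xs" "last S = padded I \<pi> ! (length \<pi> + 1)" "set S \<subseteq> nodes I"
        "filter (\<lambda>v. v \<in> customers I) S = take (length \<pi> + 1) \<pi>"
        "lab_dist l = ereal (total_distance I S)"
      and ok: "cargo_ok I (lab_cargo l) [] \<longrightarrow> cargo_ok I 0 (xs @ [])"
        "battery_ok I (lab_battery l) (padded I \<pi> ! (length \<pi> + 1)) [] \<longrightarrow>
           battery_ok I 0 (depot I) (xs @ [])"
      by blast
    have "is_solution I \<pi> S"
      using S(1-4) by (simp add: is_solution_def padded_nth)
    then have "feasible I \<pi> S"
      using ok unfolding S(1) by (intro ok_imp_feasible caps) simp_all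
    moreover have "total_distance I S \<le> total_distance I S'" if "feasible I \<pi> S'" for S'
    proof -
      from complete[OF that] obtain l' where "l' \<in> ?F" "lab_dist l' \<le> total_distance I S'"
        by blast
      then have "lab_dist l \<le> ereal (total_distance I S')"
        using 2(3) order_trans by blast
      then show ?thesis using S(5) by simp
    qed
    ultimately show ?thesis using 2(1) by blast
  qed
  ultimately show ?thesis by blast
qed

end
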